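(* For any braid diagram $B$, the rank, determinant, trace, eigenvalues and characteristic polynomial of the OU matrix $M_B(\pi)$ do not depend on the strand permutation $\pi$.
   Context: An $n$-braid diagram $B$ ($n\ge 1$) is the planar diagram of a braid on $n$ strands, given by a word in $\sigma_1^{\pm1},\dots,\sigma_{n-1}^{\pm1}$ read from top to bottom; $\sigma_k$ (a positive crossing) is a crossing of the strands currently at positions $k$ and $k+1$ in which the strand going from position $k$ to position $k+1$ passes under the other, and $\sigma_k^{-1}$ is the same with the other strand passing under. The strands are labelled $s_1,\dots,s_n$ from left to right at the top. A strand permutation $\pi$ of $\{1,\dots,n\}$ corresponds to the sequence of strands $\mathbf{s}=(s_{\pi(1)},\dots,s_{\pi(n)})$. The OU (over-under) matrix $M(B_{\mathbf{s}})=M_B(\pi)$ is the $n\times n$ matrix with zero diagonal whose $(i,j)$-entry for $i\neq j$ is the number of crossings of $B$ at which $s_{\pi(i)}$ passes over $s_{\pi(j)}$. *)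

theory Defs
  imports
    "HOL-Combinatorics.Permutations"
    "Jordan_Normal_Form.DL_Rank"
    "Jordan_Normal_Form.Spectral_Radius"
begin

text \<open>\<open>Sig k\<close> is the generator \<open>\<sigma>\<^sub>k\<close> and \<open>SigInv k\<close> is its inverse \<open>\<sigma>\<^sub>k\<^sup>-\<^sup>1\<close>; the crossing is between
  the positions \<open>k\<close> and \<open>k + 1\<close>, where positions are numbered from 1.\<close>

datatype braid_letter = Sig nat | SigInv nat

fun crossing_pos :: "braid_letter \<Rightarrow> nat" where
  "crossing_pos (Sig k) = k"
| "crossing_pos (SigInv k) = k"

definition braid_diagram :: "nat \<Rightarrow> braid_letter list \<Rightarrow> bool" where
  "braid_diagram n B \<longleftrightarrow> 1 \<le> n \<and> (\<forall>c\<in>set B. 1 \<le> crossing_pos c \<and> crossing_pos c < n)"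

text \<open>In the next two functions, \<open>p\<close> maps each position to the label of the strand that is
  currently there. The result \<open>(a, b)\<close> of \<open>over_under\<close> means that strand \<open>a\<close> passes over strand \<open>b\<close>:
  at \<open>\<sigma>\<^sub>k\<close> the strand going from position \<open>k\<close> to position \<open>k + 1\<close> is the lower one.\<close>

fun over_under :: "(nat \<Rightarrow> nat) \<Rightarrow> braid_letter \<Rightarrow> nat \<times> nat" where
  "over_under p (Sig k) = (p (Suc k), p k)"
| "over_under p (SigInv k) = (p k, p (Suc k))"

fun crossings :: "(nat \<Rightarrow> nat) \<Rightarrow> braid_letter list \<Rightarrow> (nat \<times> nat) list" where
  "crossings p [] = []"
| "crossings p (c # B) =
     over_under p c # crossings (p \<circ> transpose (crossing_pos c) (Suc (crossing_pos c))) B"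

text \<open>At the top, the strand at position \<open>i\<close> is \<open>s\<^sub>i\<close>, so the reading starts with \<open>id\<close>.\<close>

definition over_count :: "braid_letter list \<Rightarrow> nat \<Rightarrow> nat \<Rightarrow> nat" where
  "over_count B a b = count_list (crossings id B) (a, b)"

text \<open>Matrix indices start at 0 while strands are labelled \<open>1, \<dots>, n\<close>, hence the shifts.\<close>

definition OU_matrix :: "nat \<Rightarrow> braid_letter list \<Rightarrow> (nat \<Rightarrow> nat) \<Rightarrow> int mat" where
  "OU_matrix n B \<pi> = mat n n (\<lambda>(i, j).
     if i = j then 0 else int (over_count B (\<pi> (Suc i)) (\<pi> (Suc j))))"

definition mat_trace :: "'a::comm_monoid_add mat \<Rightarrow> 'a" where
  "mat_trace A = (\<Sum>i<dim_row A. A $$ (i, i))"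

end

theory Submission
  imports Defs
begin

text \<open>Writing \<open>P\<close> for the permutation matrix of \<open>\<pi>\<close>, the matrix \<open>M\<^sub>B(\<pi>)\<close> is \<open>P M\<^sub>B(id) P\<^sup>T\<close>, so all OU
  matrices of \<open>B\<close> are similar to each other.\<close>

lemma similar_mat_permute:
  fixes A :: "'a :: comm_ring_1 mat"
  assumes A: "A \<in> carrier_mat n n" and p: "p permutes {0..<n}"
  shows "similar_mat (mat n n (\<lambda>(i, j). A $$ (p i, p j))) A"
proof -
  \<comment> \<open>Row \<open>i\<close> of \<open>P\<close> has its 1 in column \<open>p i\<close>,
    and \<open>Q\<close> is the transpose of \<open>P\<close>. Left multiplication by
    \<open>P\<close> moves row \<open>p i\<close> to row \<open>i\<close>; right multiplication by
    \<open>Q\<close> does the same to columns.\<close>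
  define P Q :: "'a mat"
    where "P = mat n n (\<lambda>(i, j). if j = p i then 1 else 0)"
      and "Q = mat n n (\<lambda>(i, j). if i = p j then 1 else 0)"
  have p_less: "p i < n" if "i < n" for i
    using permutes_in_image[OF p] that by simp
  have p_eq: "p i = p j \<longleftrightarrow> i = j" for i j
    using permutes_inj[OF p] by (simp add: inj_eq)
  have carrier: "P \<in> carrier_mat n n" "Q \<in> carrier_mat n n"
    by (simp_all add: P_def Q_def)
  have P_mult: "P * M = mat n n (\<lambda>(i, j). M $$ (p i, j))" if M: "M \<in> carrier_mat n n" for M
  proof (rule eq_matI)
    fix i j assume "i < dim_row (mat n n (\<lambda>(i, j). M $$ (p i, j)))"
      and "j < dim_col (mat n n (\<lambda>(i, j). M $$ (p i, j)))"
    then have i: "i < n" and j: "j < n" by simp_all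
    have "(P * M) $$ (i, j) = (\<Sum>k = 0..<n. P $$ (i, k) * M $$ (k, j))"
      using carrier(1) M i j by (simp add: scalar_prod_def)
    also have "\<dots> = (\<Sum>k = 0..<n. if k = p i then M $$ (k, j) else 0)"
      using i by (intro sum.cong) (simp_all add: P_def)
    also have "\<dots> = M $$ (p i, j)"
      using p_less[OF i] by simp
    finally show "(P * M) $$ (i, j) = mat n n (\<lambda>(i, j). M $$ (p i, j)) $$ (i, j)"
      using i j by simp
  qed (use carrier M in simp_all)
  have mult_Q: "M * Q = mat n n (\<lambda>(i, j). M $$ (i, p j))" if M: "M \<in> carrier_mat n n" for M
  proof (rule eq_matI)
    fix i j assume "i < dim_row (mat n n (\<lambda>(i, j). M $$ (i, p j)))"
      and "j < dim_col (mat n n (\<lambda>(i, j). M $$ (i, p j)))"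
    then have i: "i < n" and j: "j < n" by simp_all
    have "(M * Q) $$ (i, j) = (\<Sum>k = 0..<n. M $$ (i, k) * Q $$ (k, j))"
      using carrier(2) M i j by (simp add: scalar_prod_def)
    also have "\<dots> = (\<Sum>k = 0..<n. if k = p j then M $$ (i, k) else 0)"
      using j by (intro sum.cong) (simp_all add: Q_def)
    also have "\<dots> = M $$ (i, p j)"
      using p_less[OF j] by simp
    finally show "(M * Q) $$ (i, j) = mat n n (\<lambda>(i, j). M $$ (i, p j)) $$ (i, j)"
      using i j by simp
  qed (use carrier M in simp_all)
  have PQ: "P * Q = 1\<^sub>m n"
    unfolding P_mult[OF carrier(2)] by (rule eq_matI) (simp_all add: Q_def p_less p_eq)
  have QP: "Q * P = 1\<^sub>m n"
  proof (rule eq_matI)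
    fix i j assume "i < dim_row (1\<^sub>m n :: 'a mat)" and "j < dim_col (1\<^sub>m n :: 'a mat)"
    then have i: "i < n" and j: "j < n" by simp_all
    \<comment> \<open>Only the preimage \<open>k\<close> of \<open>i\<close> under \<open>p\<close>
      makes \<open>Q $$ (i, k)\<close> nonzero, and there \<open>P $$ (k, j)\<close> is 1 exactly
      when \<open>j = p k = i\<close>.\<close>
    have p_eq_iff: "i = p k \<longleftrightarrow> k = inv_into UNIV p i" for k
      using permutes_inverses[OF p] by metis
    have "(Q * P) $$ (i, j) = (\<Sum>k = 0..<n. Q $$ (i, k) * P $$ (k, j))"
      using carrier i j by (simp add: scalar_prod_def)
    also have "\<dots> = (\<Sum>k = 0..<n. if k = inv_into UNIV p i then if i = j then 1 else 0 else 0)"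
      using i j by (intro sum.cong) (auto simp: P_def Q_def p_eq_iff permutes_inverses[OF p])
    also have "\<dots> = (if i = j then 1 else 0)"
      using permutes_in_image[OF permutes_inv[OF p], of i] i by simp
    finally show "(Q * P) $$ (i, j) = 1\<^sub>m n $$ (i, j)"
      using i j by simp
  qed (use carrier in simp_all)
  have "P * A * Q = mat n n (\<lambda>(i, j). A $$ (p i, p j))"
    unfolding P_mult[OF A] by (subst mult_Q) (auto simp: p_less)
  then show ?thesis
    using A carrier by (intro similar_matI[OF _ PQ QP]) auto
qed

text \<open>If \<open>A = P * B * Q\<close> with \<open>P\<close> and \<open>Q\<close> inverse to
  each other, multiplication by \<open>P\<close> maps the column space of \<open>B\<close>
  isomorphically onto that of \<open>A\<close>, and rank is the dimension of the column
  space.\<close>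

lemma (in vec_space) rank_similar_mat:
  assumes A: "A \<in> carrier_mat n n" and sim: "similar_mat A B"
  shows "rank A = rank B"
proof -
  from sim obtain P Q where wit: "similar_mat_wit A B P Q"
    unfolding similar_mat_def by blast
  note w = similar_mat_witD2[OF A wit]
  have space: "span (set (cols M)) = {M *\<^sub>v x | x. x \<in> carrier_vec n}"
    if "M \<in> carrier_mat n n" for M
    using col_space_eq[OF that] that unfolding col_space_def by force
  have Q_P: "Q *\<^sub>v (P *\<^sub>v x) = x" if "x \<in> carrier_vec n" for x
    using w(2,6,7) that by (simp flip: assoc_mult_mat_vec[of _ n n _ n])
  then have inj: "inj_on (\<lambda>v. P *\<^sub>v v) (carrier_vec n)"
    by (rule inj_on_inverseI)
  have image: "(\<lambda>v. P *\<^sub>v v) ` span (set (cols B)) = span (set (cols A))"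
  proof (rule Set.set_eqI)
    fix y
    have A_eq: "A *\<^sub>v x = P *\<^sub>v (B *\<^sub>v (Q *\<^sub>v x))" if "x \<in> carrier_vec n" for x
    proof -
      have "Q *\<^sub>v x \<in> carrier_vec n"
        using w(7) that by simp
      then show ?thesis
        unfolding w(3) using w(5-7) that by (simp add: assoc_mult_mat_vec[of _ n n _ n])
    qed
    have P_B: "P *\<^sub>v (B *\<^sub>v x) = A *\<^sub>v (P *\<^sub>v x)" if "x \<in> carrier_vec n" for x
      using A_eq[of "P *\<^sub>v x"] Q_P[OF that] w(6) that by simp
    have "y \<in> (\<lambda>v. P *\<^sub>v v) ` span (set (cols B)) \<longleftrightarrow>
        (\<exists>x\<in>carrier_vec n. y = P *\<^sub>v (B *\<^sub>v x))"
      unfolding space[OF w(5)] by blast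
    \<comment> \<open>A vector \<open>x\<close> for the left side gives \<open>P *\<^sub>v x\<close>
      for the right side; conversely, \<open>x\<close> on the right gives
      \<open>Q *\<^sub>v x\<close> on the left.\<close>
    also have "\<dots> \<longleftrightarrow> (\<exists>x\<in>carrier_vec n. y = A *\<^sub>v x)"
      using A_eq P_B w(6,7) mult_mat_vec_carrier by metis
    finally show "y \<in> (\<lambda>v. P *\<^sub>v v) ` span (set (cols B)) \<longleftrightarrow> y \<in> span (set (cols A))"
      unfolding space[OF A] by blast
  qed
  have hom: "(\<lambda>v. P *\<^sub>v v) \<in>
      LinearCombinations.module_hom class_ring (span_vs (set (cols B))) (span_vs (set (cols A)))"
    using image w(6) unfolding LinearCombinations.module_hom_def
    by (auto simp: space[OF w(5)] mult_mat_vec_carrier[OF w(5)]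
        mult_add_distrib_mat_vec[OF w(6)] mult_mat_vec[OF w(6)])
  have vs: "vectorspace class_ring (span_vs (set (cols M)))" if "M \<in> carrier_mat n n" for M
    by (rule subspace_is_vs[OF span_is_subspace]) (use cols_dim[of M] that in auto)
  \<comment> \<open>The map is restricted to the column spaces, taken as vector spaces of their own,
    so that injectivity and surjectivity yield equal dimensions.\<close>
  have T: "linear_map class_ring (span_vs (set (cols B))) (span_vs (set (cols A))) (\<lambda>v. P *\<^sub>v v)"
    using vs[OF A] vs[OF w(5)] hom
    unfolding linear_map_def mod_hom_def mod_hom_axioms_def vectorspace_def by blast
  have "span (set (cols B)) \<subseteq> carrier_vec n"
    using w(5) by (auto simp: space)
  then have "inj_on (\<lambda>v. P *\<^sub>v v) (span (set (cols B)))"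
    using inj inj_on_subset by blast
  then show ?thesis
    using linear_map.dim_eq[OF T fin_dim_span_cols[OF w(5)]] image
    unfolding rank_def by simp
qed

text \<open>Relabelling by \<pi> moves rows and columns simultaneously, so this is an instance of
  \<open>similar_mat_permute\<close> once \<pi> is translated to indices starting at 0.\<close>

lemma OU_matrix_similar:
  assumes "\<pi> permutes {1..n}"
  shows "similar_mat (OU_matrix n B \<pi>) (OU_matrix n B id)"
proof -
  \<comment> \<open>This is \<pi> conjugated by the shift. For \<open>i < n\<close> the value
    \<open>\<pi> (Suc i)\<close> is at least 1, so the truncated subtraction loses nothing; for
    \<open>i \<ge> n\<close> it returns \<open>i\<close>, as \<open>permutes\<close>
    demands.\<close>
  define p where "p i = \<pi> (Suc i) - 1" for i
  have Suc_p: "Suc (p i) = \<pi> (Suc i)" if "i < n" for i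
    using permutes_in_image[OF assms, of "Suc i"] that by (simp add: p_def)
  have p_less: "p i < n" if "i < n" for i
    using permutes_in_image[OF assms, of "Suc i"] that by (auto simp: p_def)
  have p_eq: "p i = p j \<longleftrightarrow> i = j" if "i < n" "j < n" for i j
    using permutes_inj[OF assms] Suc_p that by (metis injD nat.inject)
  have "p ` {0..<n} = {0..<n}"
    by (rule endo_inj_surj) (auto simp: inj_on_def p_less p_eq)
  then have "bij_betw p {0..<n} {0..<n}"
    by (auto simp: bij_betw_def inj_on_def p_eq)
  moreover have "p i = i" if "i \<notin> {0..<n}" for i
    using permutes_not_in[OF assms, of "Suc i"] that by (auto simp: p_def)
  ultimately have p: "p permutes {0..<n}"
    by (rule bij_imp_permutes)
  \<comment> \<open>Injectivity of \<open>p\<close> sends diagonal positions to diagonal positions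
    and all others off the diagonal, so the zero diagonal is respected.\<close>
  have "OU_matrix n B \<pi> = mat n n (\<lambda>(i, j). OU_matrix n B id $$ (p i, p j))"
    by (rule eq_matI) (auto simp: OU_matrix_def p_less p_eq Suc_p)
  then show ?thesis
    using similar_mat_permute[OF _ p, of "OU_matrix n B id"] by (simp add: OU_matrix_def)
qed

text \<open>Entrywise application of a homomorphism preserves products and the identity matrix, so
  it carries the witnesses \<open>P\<close> and \<open>Q\<close> along. This transfers similarity
  from the integers to the reals for the rank and to the complex numbers for the spectrum.\<close>

lemma (in semiring_hom) similar_mat_hom:
  assumes "similar_mat A B"
  shows "similar_mat (mat\<^sub>h A) (mat\<^sub>h B)"
proof -
  from similar_matD[OF assms] obtain n P Q
    where carrier: "{A, B, P, Q} \<subseteq> carrier_mat n n"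
      and PQ: "P * Q = 1\<^sub>m n" and QP: "Q * P = 1\<^sub>m n" and A: "A = P * B * Q"
    by blast
  have "mat\<^sub>h P * mat\<^sub>h Q = 1\<^sub>m n" "mat\<^sub>h Q * mat\<^sub>h P = 1\<^sub>m n"
    using carrier PQ QP mat_hom_mult[of P n n Q n] mat_hom_mult[of Q n n P n] mat_hom_one[of n]
    by simp_all
  moreover have "mat\<^sub>h A = mat\<^sub>h P * mat\<^sub>h B * mat\<^sub>h Q"
    using carrier mat_hom_mult[of P n n B n] mat_hom_mult[of "P * B" n n Q n] unfolding A by auto
  ultimately show ?thesis
    using carrier by (intro similar_matI[of _ _ "mat\<^sub>h P" "mat\<^sub>h Q" n]) auto
qed

theorem corollary1:
  fixes n :: nat and B :: "braid_letter list" and \<pi> \<pi>' :: "nat \<Rightarrow> nat"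
  assumes "braid_diagram n B"
    and "\<pi> permutes {1..n}"
    and "\<pi>' permutes {1..n}"
  shows "vec_space.rank n (map_mat real_of_int (OU_matrix n B \<pi>))
           = vec_space.rank n (map_mat real_of_int (OU_matrix n B \<pi>'))
    \<and> det (OU_matrix n B \<pi>) = det (OU_matrix n B \<pi>')
    \<and> mat_trace (OU_matrix n B \<pi>) = mat_trace (OU_matrix n B \<pi>')
    \<and> spectrum (map_mat complex_of_int (OU_matrix n B \<pi>))
           = spectrum (map_mat complex_of_int (OU_matrix n B \<pi>'))
    \<and> char_poly (OU_matrix n B \<pi>) = char_poly (OU_matrix n B \<pi>')"
proof (intro conjI)
  have carrier: "OU_matrix n B \<sigma> \<in> carrier_mat n n" for \<sigma>
    by (simp add: OU_matrix_def)
  \<comment> \<open>Both matrices are similar to the one for \<open>id\<close>.\<close>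
  have sim: "similar_mat (OU_matrix n B \<pi>) (OU_matrix n B \<pi>')"
    using OU_matrix_similar assms similar_mat_sym similar_mat_trans by metis
  show "vec_space.rank n (map_mat real_of_int (OU_matrix n B \<pi>))
      = vec_space.rank n (map_mat real_of_int (OU_matrix n B \<pi>'))"
    using carrier by (intro vec_space.rank_similar_mat of_int_hom.similar_mat_hom sim) simp
  show "det (OU_matrix n B \<pi>) = det (OU_matrix n B \<pi>')"
    by (rule det_similar[OF sim])
  \<comment> \<open>Both diagonals vanish, so both traces are 0.\<close>
  show "mat_trace (OU_matrix n B \<pi>) = mat_trace (OU_matrix n B \<pi>')"
    by (simp add: mat_trace_def OU_matrix_def)
  show "char_poly (OU_matrix n B \<pi>) = char_poly (OU_matrix n B \<pi>')"
    by (rule char_poly_similar[OF sim])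
  show "spectrum (map_mat complex_of_int (OU_matrix n B \<pi>))
      = spectrum (map_mat complex_of_int (OU_matrix n B \<pi>'))"
    \<comment> \<open>The eigenvalues are the roots of the characteristic polynomial, which similar
      complex matrices share.\<close>
    using char_poly_similar[OF of_int_hom.similar_mat_hom[OF sim, where 'a = complex]]
      carrier spectrum_root_char_poly
    by (metis map_carrier_mat)
qed

end
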